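(* Suppose there exists a $t$-$(v,k,1)$-design such that $\frac{k}{2}+1<t\leq k$. Let $t_1,t_2$ be positive integers such that $\max\{t_1,t_2\}<t$ and $t_1+t_2=k$. Then for each of the following three sets of parameters, every $(K,M,N)$ caching system with the given $K$ and the given ratio $\frac{M}{N}$ admits an $F$-division caching scheme with rate $R$: 1) $K=\binom{v}{t_1}$, $\ \frac{M}{N}=1-\dfrac{\binom{v-t_1}{t-t_1}}{\binom{k-t_1}{t-t_1}\binom{v}{t_2}}$, $\ R=\dfrac{\binom{v}{t}}{\binom{k}{t}\binom{v}{t_2}}$, $\ F=\binom{v}{t_2}$; 2) $K=\binom{v}{t_1}$, $\ \frac{M}{N}=1-\dfrac{\binom{k}{t_1}}{\binom{v}{t_1}}$, $\ R=\dfrac{\binom{v}{t_2}\binom{k}{t}}{\binom{v}{t}}$, $\ F=\dfrac{\binom{v}{t}}{\binom{k}{t}}$; 3) $K=\dfrac{\binom{v}{t}}{\binom{k}{t}}$, $\ \frac{M}{N}=1-\dfrac{\binom{k}{t_1}}{\binom{v}{t_1}}$, $\ R=\dfrac{\binom{v}{t_2}}{\binom{v}{t_1}}$, $\ F=\binom{v}{t_1}$.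
   Context: $t$-design: let $v,k,\lambda,t$ be positive integers with $v>k\geq t$. A $t$-$(v,k,\lambda)$-design is a pair $(V,\mathcal{B})$, where $V$ is a set of points with $|V|=v$ and $\mathcal{B}$ is a collection (multiset) of $k$-subsets of $V$ (blocks), such that every $t$-subset of $V$ is contained in exactly $\lambda$ blocks. Its number of blocks is $\lambda\binom{v}{t}/\binom{k}{t}$. Caching system and caching scheme: fix a finite field $\mathbb{F}$ (e.g. $\mathbb{F}=\mathbb{F}_2$), and write $[n]=\{1,\dots,n\}$. A $(K,M,N)$ caching system consists of one server with $N$ files $\mathbf{W}_1,\dots,\mathbf{W}_N$ and $K$ users, each with a cache of size $M$, $0\le M\le N$. For a positive integer $F$ (the subpacketization; with $MF$ an integer), each file is a vector $\mathbf{W}_i\in\mathbb{F}^F$. An $F$-division caching scheme with rate $R$ for the $(K,M,N)$ caching system consists of: caching functions $\phi_k:\mathbb{F}^{NF}\to\mathbb{F}^{MF}$ for $k\in[K]$; encoding functions $\varphi_{\mathbf{d}}:\mathbb{F}^{NF}\to\mathbb{F}^{\lfloor RF\rfloor}$ for $\mathbf{d}\in[N]^K$; and decoding functions $\mu_{k,\mathbf{d}}:\mathbb{F}^{MF}\times\mathbb{F}^{\lfloor RF\rfloor}\to\mathbb{F}^{F}$ for $k\in[K]$, $\mathbf{d}\in[N]^K$; such that for all $k\in[K]$, all $\mathbf{d}=(d_1,\dots,d_K)\in[N]^K$, and all files $\mathbf{W}_1,\dots,\mathbf{W}_N\in\mathbb{F}^F$, $$\mathbf{W}_{d_k}=\mu_{k,\mathbf{d}}\bigl(\phi_k(\mathbf{W}_1,\dots,\mathbf{W}_N),\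 \varphi_{\mathbf{d}}(\mathbf{W}_1,\dots,\mathbf{W}_N)\bigr).$$ (Here the user index $k\in[K]$ is unrelated to the block size $k$.) *)

theory Defs
  imports Complex_Main "HOL-Library.Multiset" "HOL-Library.FuncSet" "Jordan_Normal_Form.Matrix"
begin

definition t_design ::
  "nat \<Rightarrow> nat \<Rightarrow> nat \<Rightarrow> nat \<Rightarrow> 'p set \<Rightarrow> 'p set multiset \<Rightarrow> bool" where
  "t_design t v k l V \<B> \<longleftrightarrow>
     0 < t \<and> t \<le> k \<and> k < v \<and> 0 < l \<and>
     finite V \<and> card V = v \<and>
     (\<forall>b\<in>#\<B>. b \<subseteq> V \<and> card b = k) \<and>
     (\<forall>T. T \<subseteq> V \<and> card T = t \<longrightarrow> size (filter_mset (\<lambda>b. T \<subseteq> b) \<B>) = l)"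

definition caching_system :: "nat \<Rightarrow> real \<Rightarrow> nat \<Rightarrow> bool" where
  "caching_system K M N \<longleftrightarrow> 0 < K \<and> 0 < N \<and> 0 \<le> M \<and> M \<le> real N"

text \<open>
  The elements of \<open>library N F\<close> are the tuples \<open>(W 1, \<dots>, W N)\<close> of files; this is the space of all
  vectors of length \<open>N * F\<close> cut into \<open>N\<close> consecutive pieces of length \<open>F\<close>.
\<close>

definition library :: "nat \<Rightarrow> nat \<Rightarrow> (nat \<Rightarrow> 'a vec) set" where
  "library N F = {1..N} \<rightarrow>\<^sub>E carrier_vec F"

definition demands :: "nat \<Rightarrow> nat \<Rightarrow> (nat \<Rightarrow> nat) set" where
  "demands K N = {1..K} \<rightarrow>\<^sub>E {1..N}"

text \<open>
  \<open>cache\<close>, \<open>enc\<close> and \<open>dec\<close> are the caching, encoding and decoding functions. The conditions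
  \<open>M * F \<in> \<int>\<close> and \<open>0 \<le> R\<close>, together with \<open>0 \<le> M\<close> from the caching system, ensure that the
  conversions to \<open>nat\<close> give exactly \<open>M * F\<close> and the floor of \<open>R * F\<close>.
\<close>

definition caching_scheme ::
  "nat \<Rightarrow> real \<Rightarrow> nat \<Rightarrow> nat \<Rightarrow> real \<Rightarrow>
   (nat \<Rightarrow> (nat \<Rightarrow> 'a::{field,finite} vec) \<Rightarrow> 'a vec) \<Rightarrow>
   ((nat \<Rightarrow> nat) \<Rightarrow> (nat \<Rightarrow> 'a vec) \<Rightarrow> 'a vec) \<Rightarrow>
   (nat \<Rightarrow> (nat \<Rightarrow> nat) \<Rightarrow> 'a vec \<times> 'a vec \<Rightarrow> 'a vec) \<Rightarrow> bool" where
  "caching_scheme K M N F R cache enc dec \<longleftrightarrow>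
     caching_system K M N \<and> 0 < F \<and> M * real F \<in> \<int> \<and> 0 \<le> R \<and>
     (let mem = carrier_vec (nat \<lfloor>M * real F\<rfloor>);
          msg = carrier_vec (nat \<lfloor>R * real F\<rfloor>)
      in (\<forall>j\<in>{1..K}. cache j \<in> library N F \<rightarrow> mem) \<and>
         (\<forall>d\<in>demands K N. enc d \<in> library N F \<rightarrow> msg) \<and>
         (\<forall>j\<in>{1..K}. \<forall>d\<in>demands K N. dec j d \<in> mem \<times> msg \<rightarrow> carrier_vec F) \<and>
         (\<forall>j\<in>{1..K}. \<forall>d\<in>demands K N. \<forall>W\<in>library N F.
            W (d j) = dec j d (cache j W, enc d W)))"

text \<open>The first argument fixes the finite field over which the scheme operates.\<close>

definition admits_caching_scheme ::
  "'a::{field,finite} itself \<Rightarrow> nat \<Rightarrow> real \<Rightarrow> nat \<Rightarrow> nat \<Rightarrow> real \<Rightarrow> bool" where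
  "admits_caching_scheme _ K M N F R \<longleftrightarrow>
     (\<exists>(cache :: nat \<Rightarrow> (nat \<Rightarrow> 'a vec) \<Rightarrow> 'a vec) enc dec.
        caching_scheme K M N F R cache enc dec)"

end

theory Submission
  imports Defs
begin

text \<open>
  Cut every file into packets and let user \<open>u\<close> store, of every file, all packets outside \<open>miss u\<close>.
  Colour the pairs \<open>(u, q)\<close> with \<open>q \<in> miss u\<close> so that the colour classes are induced matchings. The
  server sends one sum of requested packets per colour, and each user knows all but one of the
  summands of every sum that concerns it.

  In a Steiner system, the triples \<open>(X, Y, b)\<close> where the block \<open>b\<close> is the disjoint union of
  a \<open>t1\<close>-set \<open>X\<close> and a \<open>t2\<close>-set \<open>Y\<close> have the property that any two components determine the third, and
  colour classes are induced because no block contains another one. Letting \<open>X\<close>, \<open>Y\<close>, \<open>b\<close> play the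
  roles of user, packet and colour in three ways gives the three families of parameters.
\<close>

section \<open>Decoders, and schemes from induced matchings\<close>

text \<open>Removes explicit decoders from all later constructions. A decoder may search for any
  library consistent with the cache content and message that it sees; by \<open>determined\<close>,
  all such libraries agree on the demanded file.\<close>

lemma caching_scheme_if_determined:
  fixes cache :: "nat \<Rightarrow> (nat \<Rightarrow> 'a::{field,finite} vec) \<Rightarrow> 'a vec"
    and enc :: "(nat \<Rightarrow> nat) \<Rightarrow> (nat \<Rightarrow> 'a vec) \<Rightarrow> 'a vec"
  assumes "caching_system K M N" and "0 < F" and MF: "M * real F = real m" and RF: "R * real F = real s"
    and cache: "\<And>j W. cache j W \<in> carrier_vec m"
    and enc: "\<And>d W. enc d W \<in> carrier_vec s"
    and determined: "\<And>j d W W'. j \<in> {1..K} \<Longrightarrow> d \<in> demands K N \<Longrightarrow> W \<in> library N F \<Longrightarrow>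
      W' \<in> library N F \<Longrightarrow> cache j W = cache j W' \<Longrightarrow> enc d W = enc d W' \<Longrightarrow> W (d j) = W' (d j)"
  shows "admits_caching_scheme TYPE('a) K M N F R"
proof -
  define consistent where
    "consistent j d c e W \<longleftrightarrow> W \<in> library N F \<and> cache j W = c \<and> enc d W = e" for j d c e W
  \<comment> \<open>The value \<open>0\<^sub>v F\<close> serves pairs that arise from no library:
    \<open>dec\<close> must map all of \<open>mem \<times> msg\<close> into
    \<open>carrier_vec F\<close>.\<close>
  define dec where
    "dec j d = (\<lambda>(c, e). if Ex (consistent j d c e) then (SOME W. consistent j d c e W) (d j) else 0\<^sub>v F)"
    for j d
  have dec_eq: "dec j d (c, e) = W (d j)"
    if j: "j \<in> {1..K}" and d: "d \<in> demands K N" and W: "consistent j d c e W" for j d c e W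
  proof -
    have same: "W1 (d j) = W2 (d j)" if "consistent j d c e W1" "consistent j d c e W2" for W1 W2
      by (rule determined[OF j d, of W1 W2]) (use that in \<open>simp_all add: consistent_def\<close>)
    have "(SOME W. consistent j d c e W) (d j) = W (d j)"
      by (rule same[OF someI[of "consistent j d c e", OF W] W])
    moreover have "Ex (consistent j d c e)"
      using W by blast
    ultimately show ?thesis
      by (simp add: dec_def)
  qed
  have dec_carrier: "dec j d (c, e) \<in> carrier_vec F"
    if j: "j \<in> {1..K}" and d: "d \<in> demands K N" for j d c e
  proof (cases "Ex (consistent j d c e)")
    case True
    then obtain W where W: "consistent j d c e W" by blast
    have "d j \<in> {1..N}"
      using j d by (auto simp: demands_def)
    then show ?thesis
      using dec_eq[OF j d W] W by (auto simp: consistent_def library_def)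
  next
    case False
    then show ?thesis by (auto simp: dec_def)
  qed
  have "0 \<le> R"
  proof (rule ccontr)
    assume "\<not> 0 \<le> R"
    then have "R * real F < 0"
      using \<open>0 < F\<close> by (simp add: mult_neg_pos)
    then show False
      using RF by simp
  qed
  moreover have "W (d j) = dec j d (cache j W, enc d W)"
    if "j \<in> {1..K}" "d \<in> demands K N" "W \<in> library N F" for j d W
    using dec_eq[OF that(1,2), of "cache j W" "enc d W" W] that(3) by (simp add: consistent_def)
  ultimately have "caching_scheme K M N F R cache enc dec"
    unfolding caching_scheme_def Let_def
    using assms(1,2) cache enc dec_carrier by (auto simp: MF RF)
  then show ?thesis
    unfolding admits_caching_scheme_def by blast
qed

text \<open>
  The last assumption says that the colour classes are induced matchings; it also makes \<open>col\<close>
  injective in each argument.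
\<close>

lemma admits_caching_scheme_if_induced_matchings:
  fixes miss :: "'u \<Rightarrow> 'q set" and col :: "'u \<Rightarrow> 'q \<Rightarrow> 'c"
  assumes sys: "caching_system K M N"
    and U: "finite U" "card U = K"
    and P: "finite P" "card P = F" "0 < F"
    and C: "finite C" "card C = s"
    and ratio: "M / real N = 1 - real z / real F"
    and rate: "R * real F = real s"
    and miss: "\<And>u. u \<in> U \<Longrightarrow> miss u \<subseteq> P" "\<And>u. u \<in> U \<Longrightarrow> card (miss u) = z"
    and col: "\<And>u q. u \<in> U \<Longrightarrow> q \<in> miss u \<Longrightarrow> col u q \<in> C"
    and induced: "\<And>u u' q q'. u \<in> U \<Longrightarrow> u' \<in> U \<Longrightarrow> q \<in> miss u \<Longrightarrow> q' \<in> miss u' \<Longrightarrow>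
      col u q = col u' q' \<Longrightarrow> q' \<in> miss u \<Longrightarrow> u = u' \<and> q = q'"
  shows "admits_caching_scheme TYPE('a::{field,finite}) K M N F R"
proof -
  have N: "0 < N" and K: "0 < K"
    using sys by (auto simp: caching_system_def)
  \<comment> \<open>There is a user because \<open>K\<close> is positive; its missing set shows z
    \<le> F, so \<open>F - z\<close> is a true difference.\<close>
  obtain u0 where "u0 \<in> U"
    using U K by (metis card_gt_0_iff ex_in_conv)
  then have zF: "z \<le> F"
    using miss card_mono[OF P(1)] P(2) by metis
  have "M = real N * (1 - real z / real F)"
    using ratio N by (simp add: field_simps)
  then have MF: "M * real F = real (N * (F - z))"
    using P(3) zF by (simp add: of_nat_diff field_simps)
  obtain e where e: "bij_betw e {1..K} U"
    using ex_bij_betw_finite_nat[OF U(1)] ex_bij_betw_nat_finite_1[OF U(1)] U(2) by blast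
  \<comment> \<open>Demands are indexed by numbers and colour classes by elements of
    \<open>U\<close>; \<open>j_of\<close> translates back.\<close>
  define j_of where "j_of = inv_into {1..K} e"
  have j_of: "j_of (e j) = j" if "j \<in> {1..K}" for j
    using e that by (simp add: j_of_def bij_betw_inv_into_left)
  \<comment> \<open>Since \<open>F = card P\<close>, a packet is a single symbol of the file, the
    one at position \<open>\<pi> q\<close>.\<close>
  obtain \<pi> where \<pi>: "bij_betw \<pi> P {0..<F}"
    using ex_bij_betw_finite_nat[OF P(1)] P(2) by blast
  obtain \<gamma> where \<gamma>: "bij_betw \<gamma> {0..<s} C"
    using ex_bij_betw_nat_finite[OF C(1)] C(2) by blast
  \<comment> \<open>The map \<open>h u\<close> lays out the cache of \<open>u\<close>: cell
    \<open>i\<close> holds one stored packet of one file, and the number of cells is exactly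
    \<open>M * F\<close>.\<close>
  have "\<exists>h. bij_betw h {0..<N * (F - z)} ({1..N} \<times> (P - miss u))" if "u \<in> U" for u
  proof -
    have "card ({1..N} \<times> (P - miss u)) = N * (F - z)"
      using miss[OF that] P by (simp add: card_cartesian_product card_Diff_subset finite_subset)
    then show ?thesis
      using ex_bij_betw_nat_finite[of "{1..N} \<times> (P - miss u)"] P(1) by auto
  qed
  then obtain h where h: "\<And>u. u \<in> U \<Longrightarrow> bij_betw (h u) {0..<N * (F - z)} ({1..N} \<times> (P - miss u))"
    by metis
  define cache :: "nat \<Rightarrow> (nat \<Rightarrow> 'a vec) \<Rightarrow> 'a vec" where
    "cache j W = vec (N * (F - z)) (\<lambda>i. W (fst (h (e j) i)) $ \<pi> (snd (h (e j) i)))" for j W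
  define cls where "cls c = {(u, q). u \<in> U \<and> q \<in> miss u \<and> col u q = c}" for c
  define enc :: "(nat \<Rightarrow> nat) \<Rightarrow> (nat \<Rightarrow> 'a vec) \<Rightarrow> 'a vec" where
    "enc d W = vec s (\<lambda>i. \<Sum>(u, q)\<in>cls (\<gamma> i). W (d (j_of u)) $ \<pi> q)" for d W
  have fin_cls: "finite (cls c)" for c
    by (rule finite_subset[of _ "U \<times> P"]) (use miss(1) U(1) P(1) in \<open>auto simp: cls_def\<close>)
  show ?thesis
  proof (rule caching_scheme_if_determined[OF sys P(3) MF rate, of cache enc])
    show "cache j W \<in> carrier_vec (N * (F - z))" for j W
      by (simp add: cache_def)
    show "enc d W \<in> carrier_vec s" for d W
      by (simp add: enc_def)
    fix j d and W W' :: "nat \<Rightarrow> 'a vec"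
    assume j: "j \<in> {1..K}" and d: "d \<in> demands K N" and W: "W \<in> library N F" "W' \<in> library N F"
      and cache_eq: "cache j W = cache j W'" and enc_eq: "enc d W = enc d W'"
    have u: "e j \<in> U"
      using e j by (auto dest: bij_betwE)
    have d_range: "d i \<in> {1..N}" if "i \<in> {1..K}" for i
      using d that by (auto simp: demands_def)
    have known: "W a $ \<pi> q = W' a $ \<pi> q" if aq: "a \<in> {1..N}" "q \<in> P - miss (e j)" for a q
    proof -
      have "(a, q) \<in> h (e j) ` {0..<N * (F - z)}"
        using aq bij_betw_imp_surj_on[OF h[OF u]] by simp
      then obtain i where i: "i < N * (F - z)" "h (e j) i = (a, q)"
        by (metis (no_types, lifting) imageE atLeastLessThan_iff)
      have "cache j W $ i = cache j W' $ i"
        using cache_eq by simp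
      with i show ?thesis
        by (simp add: cache_def)
    qed
    have wanted: "W (d j) $ \<pi> q = W' (d j) $ \<pi> q" if q: "q \<in> miss (e j)" for q
    proof -
      have "col (e j) q \<in> \<gamma> ` {0..<s}"
        using col[OF u q] bij_betw_imp_surj_on[OF \<gamma>] by simp
      then obtain i where i: "i < s" "\<gamma> i = col (e j) q"
        by (metis (no_types, lifting) imageE atLeastLessThan_iff)
      let ?c = "cls (col (e j) q)"
      have mem: "(e j, q) \<in> ?c"
        using u q by (simp add: cls_def)
      have "(\<Sum>(u, q)\<in>?c. W (d (j_of u)) $ \<pi> q) = (\<Sum>(u, q)\<in>?c. W' (d (j_of u)) $ \<pi> q)"
        using arg_cong[OF enc_eq, of "\<lambda>w. w $ i"] i by (simp add: enc_def)
      \<comment> \<open>Any other pair of the class has its packet in the cache of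
        \<open>e j\<close>, since otherwise \<open>induced\<close> would identify it with
        \<open>(e j, q)\<close>. Cancelling these known summands from the transmitted sum leaves the
        wanted symbol.\<close>
      moreover have "(\<Sum>(u, q)\<in>?c - {(e j, q)}. W (d (j_of u)) $ \<pi> q) =
          (\<Sum>(u, q)\<in>?c - {(e j, q)}. W' (d (j_of u)) $ \<pi> q)"
      proof (rule sum.cong[OF refl])
        fix p
        assume "p \<in> ?c - {(e j, q)}"
        then obtain u' q' where p: "p = (u', q')" and mem': "(u', q') \<in> ?c"
          and ne: "\<not> (u' = e j \<and> q' = q)"
          by (cases p) auto
        from mem' have u': "u' \<in> U" "q' \<in> miss u'" "col u' q' = col (e j) q"
          by (auto simp: cls_def)
        have "q' \<notin> miss (e j)"
          using induced[OF u u'(1) q u'(2)] u'(3) ne by auto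
        moreover have "q' \<in> P"
          using miss(1) u' by blast
        moreover have "j_of u' \<in> {1..K}"
          using e u'(1) unfolding j_of_def by (metis bij_betw_imp_surj_on inv_into_into)
        ultimately show "(case p of (u, q) \<Rightarrow> W (d (j_of u)) $ \<pi> q) = (case p of (u, q) \<Rightarrow> W' (d (j_of u)) $ \<pi> q)"
          using known d_range p by auto
      qed
      ultimately show ?thesis
        using sum.remove[OF fin_cls mem, of "\<lambda>(u, q). W (d (j_of u)) $ \<pi> q"]
          sum.remove[OF fin_cls mem, of "\<lambda>(u, q). W' (d (j_of u)) $ \<pi> q"] j_of[OF j]
        by simp
    qed
    show "W (d j) = W' (d j)"
    proof (rule eq_vecI)
      have dim: "dim_vec (W (d j)) = F" "dim_vec (W' (d j)) = F"
        using PiE_mem[OF _ d_range[OF j]] W unfolding library_def by (meson carrier_vecD)+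
      then show "dim_vec (W (d j)) = dim_vec (W' (d j))"
        by simp
      fix i
      assume "i < dim_vec (W' (d j))"
      then have "i \<in> \<pi> ` P"
        using dim bij_betw_imp_surj_on[OF \<pi>] by simp
      then obtain q where "q \<in> P" "i = \<pi> q"
        by blast
      then show "W (d j) $ i = W' (d j) $ i"
        using known[OF d_range[OF j]] wanted by blast
    qed
  qed
qed

section \<open>Block counts in Steiner systems\<close>

text \<open>The design condition counts blocks with multiplicity. A filtered multiset of size one is
  a singleton, so later counts can use the plain set \<open>set_mset \<B>\<close>.\<close>

lemma unique_block_containing:
  assumes des: "t_design t v k 1 V \<B>" and T: "T \<subseteq> V" "card T = t"
  shows "\<exists>!b. b \<in># \<B> \<and> T \<subseteq> b"
proof -
  have "size (filter_mset (\<lambda>b. T \<subseteq> b) \<B>) = 1"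
    using des T by (simp add: t_design_def)
  then obtain b where b: "filter_mset (\<lambda>b. T \<subseteq> b) \<B> = {#b#}"
    using size_1_singleton_mset by metis
  have "set_mset (filter_mset (\<lambda>b. T \<subseteq> b) \<B>) = {b}"
    by (simp only: b set_mset_single)
  then have "b' \<in># \<B> \<and> T \<subseteq> b' \<longleftrightarrow> b' = b" for b'
    by auto
  then show ?thesis
    by auto
qed

lemma card_subsets_between:
  assumes "finite A" and X: "X \<subseteq> A" and n: "card X \<le> n"
  shows "card {T. X \<subseteq> T \<and> T \<subseteq> A \<and> card T = n} = (card A - card X) choose (n - card X)"
proof -
  have fin: "finite X"
    using assms finite_subset by blast
  have "bij_betw (\<lambda>Y. X \<union> Y) {Y. Y \<subseteq> A - X \<and> card Y = n - card X} {T. X \<subseteq> T \<and> T \<subseteq> A \<and> card T = n}"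
  proof (rule bij_betw_byWitness[where f' = "\<lambda>T. T - X"])
    show "(\<lambda>Y. X \<union> Y) ` {Y. Y \<subseteq> A - X \<and> card Y = n - card X} \<subseteq> {T. X \<subseteq> T \<and> T \<subseteq> A \<and> card T = n}"
    proof clarify
      fix Y
      assume Y: "Y \<subseteq> A - X" "card Y = n - card X"
      then have "card (X \<union> Y) = n"
        using fin n assms(1) by (subst card_Un_disjoint) (auto intro: finite_subset)
      with Y X show "X \<subseteq> X \<union> Y \<and> X \<union> Y \<subseteq> A \<and> card (X \<union> Y) = n"
        by auto
    qed
  qed (use fin in \<open>auto simp: card_Diff_subset\<close>)
  then have "card {T. X \<subseteq> T \<and> T \<subseteq> A \<and> card T = n} = card {Y. Y \<subseteq> A - X \<and> card Y = n - card X}"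
    by (rule bij_betw_same_card[symmetric])
  also have "\<dots> = (card A - card X) choose (n - card X)"
    using assms fin by (simp add: n_subsets card_Diff_subset)
  finally show ?thesis .
qed

text \<open>Double counting of the pairs \<open>(T, b)\<close> with \<open>X \<subseteq> T \<subseteq> b\<close> and \<open>card T = t\<close>.\<close>

lemma card_blocks_containing:
  assumes des: "t_design t v k 1 V \<B>" and X: "X \<subseteq> V" and n: "card X \<le> t"
  shows "card {b \<in> set_mset \<B>. X \<subseteq> b} * ((k - card X) choose (t - card X)) =
    (v - card X) choose (t - card X)"
proof -
  have V: "finite V" "card V = v" and blk: "\<And>b. b \<in># \<B> \<Longrightarrow> b \<subseteq> V \<and> card b = k"
    using des by (auto simp: t_design_def)
  let ?Ts = "{T. X \<subseteq> T \<and> T \<subseteq> V \<and> card T = t}"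
  let ?Bs = "{b \<in> set_mset \<B>. X \<subseteq> b}"
  let ?on = "\<lambda>b. {T. X \<subseteq> T \<and> T \<subseteq> b \<and> card T = t}"
  have card_on: "card (?on b) = (k - card X) choose (t - card X)" if "b \<in> ?Bs" for b
    using that card_subsets_between[OF _ _ n, of b] blk V(1) finite_subset by fastforce
  \<comment> \<open>Each \<open>T\<close> lies in exactly one block: existence gives this covering,
    uniqueness the disjointness below.\<close>
  have "card ?Ts = card (\<Union>b\<in>?Bs. ?on b)"
  proof (rule arg_cong[where f = card], intro subset_antisym subsetI)
    fix T
    assume "T \<in> ?Ts"
    moreover from this obtain b where "b \<in># \<B>" "T \<subseteq> b"
      using unique_block_containing[OF des, of T] by auto
    ultimately show "T \<in> (\<Union>b\<in>?Bs. ?on b)"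
      by auto
  next
    fix T
    assume "T \<in> (\<Union>b\<in>?Bs. ?on b)"
    then obtain b where "b \<in># \<B>" "X \<subseteq> T" "T \<subseteq> b" "card T = t"
      by auto
    then show "T \<in> ?Ts"
      using blk[of b] by auto
  qed
  also have "\<dots> = (\<Sum>b\<in>?Bs. card (?on b))"
  proof (rule card_UN_disjoint)
    show "\<forall>b\<in>?Bs. finite (?on b)"
    proof
      fix b
      assume "b \<in> ?Bs"
      then have "?on b \<subseteq> Pow V"
        using blk by blast
      then show "finite (?on b)"
        using V(1) finite_subset by blast
    qed
    show "\<forall>b\<in>?Bs. \<forall>b'\<in>?Bs. b \<noteq> b' \<longrightarrow> ?on b \<inter> ?on b' = {}"
    proof (intro ballI impI, rule ccontr)
      fix b b'
      assume b: "b \<in> ?Bs" "b' \<in> ?Bs" "b \<noteq> b'" "?on b \<inter> ?on b' \<noteq> {}"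
      then obtain T where T: "T \<subseteq> b" "T \<subseteq> b'" "card T = t"
        by auto
      then have "T \<subseteq> V"
        using b blk by blast
      then show False
        using unique_block_containing[OF des, of T] T b by auto
    qed
  qed simp
  also have "\<dots> = card ?Bs * ((k - card X) choose (t - card X))"
    using card_on by simp
  finally show ?thesis
    using card_subsets_between[OF V(1) X n] V(2) by simp
qed

section \<open>The three families of parameters\<close>

theorem theorem6:
  fixes V :: "'p set" and \<B> :: "'p set multiset" and v k t t1 t2 :: nat
  assumes "t_design t v k 1 V \<B>"
    and "real k / 2 + 1 < real t" and "t \<le> k"
    and "0 < t1" and "0 < t2" and "max t1 t2 < t" and "t1 + t2 = k"
  shows
    "(\<exists>K F. real K = real (v choose t1) \<and> real F = real (v choose t2) \<and>
        (\<forall>M N. caching_system K M N \<and>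
           M / real N = 1 - real ((v - t1) choose (t - t1)) /
                            (real ((k - t1) choose (t - t1)) * real (v choose t2)) \<longrightarrow>
           admits_caching_scheme TYPE('a::{field,finite}) K M N F
             (real (v choose t) / (real (k choose t) * real (v choose t2))))) \<and>
     (\<exists>K F. real K = real (v choose t1) \<and> real F = real (v choose t) / real (k choose t) \<and>
        (\<forall>M N. caching_system K M N \<and>
           M / real N = 1 - real (k choose t1) / real (v choose t1) \<longrightarrow>
           admits_caching_scheme TYPE('a) K M N F
             (real (v choose t2) * real (k choose t) / real (v choose t)))) \<and>
     (\<exists>K F. real K = real (v choose t) / real (k choose t) \<and> real F = real (v choose t1) \<and>
        (\<forall>M N. caching_system K M N \<and>
           M / real N = 1 - real (k choose t1) / real (v choose t1) \<longrightarrow>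
           admits_caching_scheme TYPE('a) K M N F
             (real (v choose t2) / real (v choose t1))))"
proof -
  have tk: "t \<le> k" "k < v" and V: "finite V" "card V = v"
    and blk: "\<And>b. b \<in># \<B> \<Longrightarrow> b \<subseteq> V \<and> card b = k"
    using assms(1) by (auto simp: t_design_def)
  have t12: "t1 < t" "t2 < t" "t1 + t2 = k"
    using assms(6,7) by auto
  have fin_blk: "\<And>b. b \<in># \<B> \<Longrightarrow> finite b"
    using blk V(1) finite_subset by blast
  define S where "S n = {X. X \<subseteq> V \<and> card X = n}" for n
  have S: "finite (S n)" "card (S n) = v choose n" for n
    using V by (auto simp: S_def n_subsets)
  define n\<B> where "n\<B> = card (set_mset \<B>)"
  \<comment> \<open>The number of blocks through a \<open>t1\<close>-set, the same for all of them.
    The division is exact, as the double count for one existing \<open>t1\<close>-set shows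
    below.\<close>
  define r where "r = ((v - t1) choose (t - t1)) div ((k - t1) choose (t - t1))"
  have pos: "0 < v choose t" "0 < k choose t" "0 < v choose t1" "0 < v choose t2"
    "0 < k choose t1" "0 < (k - t1) choose (t - t1)"
    using tk t12 by (auto simp: zero_less_binomial_iff)
  have n\<B>: "n\<B> * (k choose t) = v choose t"
    using card_blocks_containing[OF assms(1), of "{}"] by (simp add: n\<B>_def)
  then have n\<B>_pos: "0 < n\<B>"
    using pos by (cases n\<B>) auto
  have n\<B>_eq: "real n\<B> = real (v choose t) / real (k choose t)"
    using n\<B> pos(2) by (simp add: field_simps flip: of_nat_mult)
  have card_r: "card {b \<in> set_mset \<B>. X \<subseteq> b} = r" if "X \<in> S t1" for X
    using card_blocks_containing[OF assms(1), of X] that t12 pos(6)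
    unfolding S_def r_def by (metis (mono_tags, lifting) mem_Collect_eq nat_less_le
        nonzero_mult_div_cancel_right)
  have r: "r * ((k - t1) choose (t - t1)) = (v - t1) choose (t - t1)"
  proof -
    obtain X where "X \<in> S t1"
      using S[of t1] pos(3) by (metis card_gt_0_iff ex_in_conv)
    then show ?thesis
      using card_blocks_containing[OF assms(1), of X] card_r t12 by (auto simp: S_def)
  qed
  \<comment> \<open>Both sides count incident pairs of a \<open>t1\<close>-set and a block. The
    derivation is arithmetical: rewrite both products with \<open>choose_mult\<close> and cancel the
    common factor.\<close>
  have "r * (v choose t1) = n\<B> * (k choose t1)"
  proof -
    have "(v choose t) * (t choose t1) = (v choose t1) * ((v - t1) choose (t - t1))"
      "(k choose t) * (t choose t1) = (k choose t1) * ((k - t1) choose (t - t1))"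
      using tk t12 by (auto intro!: choose_mult)
    then have "(r * (v choose t1)) * ((k - t1) choose (t - t1)) =
        (n\<B> * (k choose t1)) * ((k - t1) choose (t - t1))"
      using r n\<B> by (metis mult.assoc mult.commute)
    then show ?thesis
      using pos(6) by simp
  qed
  then have ratio2: "real (k choose t1) / real (v choose t1) = real r / real n\<B>"
    using pos(3) n\<B>_pos by (simp add: field_simps flip: of_nat_mult)
  have ratio1: "real ((v - t1) choose (t - t1)) / (real ((k - t1) choose (t - t1)) * real (v choose t2))
      = real r / real (v choose t2)"
    using pos(6) by (simp flip: r)
  have diff: "b - X \<in> S t2" if "b \<in># \<B>" "X \<in> S t1" "X \<subseteq> b" for b X
    using that blk t12 V(1) finite_subset[of X V] by (auto simp: S_def card_Diff_subset)
  \<comment> \<open>All blocks are finite of the same size \<open>k\<close>, so they form an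
    antichain.\<close>
  have blk_eq: "b = b'" if "b \<in># \<B>" "b' \<in># \<B>" "b \<subseteq> b'" for b b'
    using that blk fin_blk by (metis card_subset_eq)
  show ?thesis
  proof (intro conjI)
    \<comment> \<open>First family: users are \<open>t1\<close>-sets, packets are
      \<open>t2\<close>-sets, and the colour is the block \<open>X \<union> Y\<close>. Removing
      \<open>X\<close> from the blocks through it gives the \<open>r\<close> missing
      packets.\<close>
    define miss where "miss X = {Y \<in> S t2. X \<inter> Y = {} \<and> X \<union> Y \<in># \<B>}" for X
    have card_miss: "card (miss X) = r" if X: "X \<in> S t1" for X
    proof -
      have "bij_betw (\<lambda>b. b - X) {b \<in> set_mset \<B>. X \<subseteq> b} (miss X)"
      proof (rule bij_betw_byWitness[where f' = "\<lambda>Y. X \<union> Y"])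
        show "(\<lambda>b. b - X) ` {b \<in> set_mset \<B>. X \<subseteq> b} \<subseteq> miss X"
          using diff X by (auto simp: miss_def Un_absorb1)
      qed (auto simp: miss_def)
      then show ?thesis
        using card_r[OF X] bij_betw_same_card by metis
    qed
    \<comment> \<open>With \<open>Y' \<in> miss X\<close>, the block \<open>X \<union> Y'\<close>
      lies inside the common block \<open>X \<union> Y\<close>, hence equals it. Disjointness then
      gives \<open>Y = Y'\<close> and, by complements, \<open>X = X'\<close>.\<close>
    have induced: "X = X' \<and> Y = Y'"
      if "Y \<in> miss X" "Y' \<in> miss X'" "X \<union> Y = X' \<union> Y'" "Y' \<in> miss X" for X X' Y Y'
    proof -
      have "X \<union> Y' = X \<union> Y"
        using that by (intro blk_eq) (auto simp: miss_def)
      then show ?thesis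
        using that by (auto simp: miss_def)
    qed
    have "admits_caching_scheme TYPE('a) (v choose t1) M N (v choose t2)
        (real (v choose t) / (real (k choose t) * real (v choose t2)))"
      if "caching_system (v choose t1) M N" "M / real N = 1 - real r / real (v choose t2)" for M N
      proof (rule admits_caching_scheme_if_induced_matchings[OF that(1) S S pos(4) finite_set_mset
            n\<B>_def[symmetric] that(2), where miss = miss and col = "(\<union>)"])
      show "miss X \<subseteq> S t2" for X
        by (auto simp: miss_def)
      show "X \<union> Y \<in># \<B>" if "Y \<in> miss X" for X Y
        using that by (simp add: miss_def)
    qed (use pos n\<B>_eq in \<open>simp_all add: card_miss induced\<close>)
    then show "\<exists>K F. real K = real (v choose t1) \<and> real F = real (v choose t2) \<and>
        (\<forall>M N. caching_system K M N \<and>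
           M / real N = 1 - real ((v - t1) choose (t - t1)) /
                            (real ((k - t1) choose (t - t1)) * real (v choose t2)) \<longrightarrow>
           admits_caching_scheme TYPE('a) K M N F
             (real (v choose t) / (real (k choose t) * real (v choose t2))))"
      unfolding ratio1 by blast
  next
    \<comment> \<open>Second family: users are \<open>t1\<close>-sets, packets are blocks, and the
      colour is the \<open>t2\<close>-set \<open>b - X\<close>. If also
      \<open>X \<subseteq> b'\<close>, then \<open>b'\<close> contains both \<open>X\<close> and
      \<open>b - X = b' - X'\<close>, hence all of \<open>b\<close>.\<close>
    define miss where "miss X = {b \<in> set_mset \<B>. X \<subseteq> b}" for X
    have induced: "X = X' \<and> b = b'"
      if "b \<in> miss X" "b' \<in> miss X'" "b - X = b' - X'" "b' \<in> miss X" for X X' b b'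
    proof -
      have "b = b'"
        using that by (intro blk_eq) (auto simp: miss_def)
      then show ?thesis
        using that by (auto simp: miss_def)
    qed
    have "admits_caching_scheme TYPE('a) (v choose t1) M N n\<B>
        (real (v choose t2) * real (k choose t) / real (v choose t))"
      if "caching_system (v choose t1) M N" "M / real N = 1 - real r / real n\<B>" for M N
      proof (rule admits_caching_scheme_if_induced_matchings[OF that(1) S finite_set_mset
            n\<B>_def[symmetric] n\<B>_pos S that(2), where miss = miss and col = "\<lambda>X b. b - X"])
      show "miss X \<subseteq> set_mset \<B>" for X
        by (auto simp: miss_def)
      show "b - X \<in> S t2" if "X \<in> S t1" "b \<in> miss X" for X b
        using that diff by (simp add: miss_def)
      show "card (miss X) = r" if "X \<in> S t1" for X
        using card_r[OF that] by (simp add: miss_def)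
    qed (use pos n\<B>_eq in \<open>simp_all add: induced\<close>)
    then show "\<exists>K F. real K = real (v choose t1) \<and> real F = real (v choose t) / real (k choose t) \<and>
        (\<forall>M N. caching_system K M N \<and>
           M / real N = 1 - real (k choose t1) / real (v choose t1) \<longrightarrow>
           admits_caching_scheme TYPE('a) K M N F
             (real (v choose t2) * real (k choose t) / real (v choose t)))"
      unfolding ratio2 n\<B>_eq[symmetric] by blast
  next
    \<comment> \<open>Third family: the second with users and packets exchanged. Now
      \<open>X' \<subseteq> b\<close> places \<open>b'\<close> inside \<open>b\<close>.\<close>
    define miss where "miss b = {X \<in> S t1. X \<subseteq> b}" for b
    have card_miss: "card (miss b) = k choose t1" if "b \<in># \<B>" for b
    proof -
      have "miss b = {X. X \<subseteq> b \<and> card X = t1}"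
        using blk[OF that] by (auto simp: miss_def S_def)
      then show ?thesis
        using n_subsets[OF fin_blk[OF that]] blk[OF that] by simp
    qed
    have induced: "b = b' \<and> X = X'"
      if "b \<in># \<B>" "b' \<in># \<B>" "X \<in> miss b" "X' \<in> miss b'" "b - X = b' - X'" "X' \<in> miss b" for b b' X X'
    proof -
      have "b' = b"
        using that by (intro blk_eq) (auto simp: miss_def)
      then show ?thesis
        using that by (auto simp: miss_def)
    qed
    have "admits_caching_scheme TYPE('a) n\<B> M N (v choose t1)
        (real (v choose t2) / real (v choose t1))"
      if "caching_system n\<B> M N" "M / real N = 1 - real (k choose t1) / real (v choose t1)" for M N
      proof (rule admits_caching_scheme_if_induced_matchings[OF that(1) finite_set_mset
            n\<B>_def[symmetric] S pos(3) S that(2), where miss = miss and col = "\<lambda>b X. b - X"])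
      show "miss b \<subseteq> S t1" for b
        by (auto simp: miss_def)
      show "b - X \<in> S t2" if "b \<in># \<B>" "X \<in> miss b" for b X
        using that diff by (simp add: miss_def)
      show "b = b' \<and> X = X'"
        if "b \<in># \<B>" "b' \<in># \<B>" "X \<in> miss b" "X' \<in> miss b'" "b - X = b' - X'" "X' \<in> miss b" for b b' X X'
        using induced[OF that] .
    qed (use pos in \<open>simp_all add: card_miss\<close>)
    then show "\<exists>K F. real K = real (v choose t) / real (k choose t) \<and> real F = real (v choose t1) \<and>
        (\<forall>M N. caching_system K M N \<and>
           M / real N = 1 - real (k choose t1) / real (v choose t1) \<longrightarrow>
           admits_caching_scheme TYPE('a) K M N F
             (real (v choose t2) / real (v choose t1)))"
      unfolding n\<B>_eq[symmetric] by blast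
  qed
qed

end
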